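(* Let $M=\{1^{k_{1}},2^{k_{2}},\ldots,m^{k_{m}}\}$ with $k_{i}\geq1$ for all $i\in[m]$, and let $\tau$ be a consecutive permutation of $[m]$. Then for every positive integer $d$, \[ \sum_{w\in\mathfrak{S}_{M}^{\tau}}q^{\mathrm{INV}(w)}=\sum_{w\in\mathfrak{S}_{M}^{\tau}}q^{\mathrm{MAJ}(w)}=\sum_{w\in\mathfrak{S}_{M}^{\tau}}q^{\mathrm{MAJ}_{d}(w)}=\sum_{w\in\mathfrak{S}_{M}^{\tau}}q^{\mathrm{Z}(w)}. \]
   Context: $\mathfrak{S}_M$ is the set of words $w=w_1\cdots w_n$ that are rearrangements of the multiset $M$ ($k_i$ copies of $i$, $n=\sum k_i$). The tail permutation of $w$ is the subword $w_{t_1}\cdots w_{t_m}$ ($t_1<\dots<t_m$) formed by the last (rightmost) occurrences of the letters; it is a permutation of $[m]$. $\mathfrak{S}_M^\tau$ is the set of $w\in\mathfrak{S}_M$ with tail permutation $\tau$. A permutation $\tau_1\cdots\tau_m$ of $[m]$ is consecutive if $\{\tau_1,\dots,\tau_i\}$ is a set of consecutive integers for every $i\in[m]$. Statistics: $\mathrm{INV}(w)=|\{(i,j):i<j,w_i>w_j\}|$; $\mathrm{MAJ}(w)=\sum_{i:w_i>w_{i+1}}i$; $\mathrm{MAJ}_d(w)=|\{(i,j):i<j<i+d,\ w_i>w_j\}|+\sum_{i:\,w_i>w_{i+d}}i$; $\mathrm{Z}(w)=\sum_{i<j}\mathrm{MAJ}(w_{ij})$, where $w_{ij}$ is the subword of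 $w$ consisting of the letters equal to $i$ or $j$. *)

theory Defs
  imports "HOL-Combinatorics.Multiset_Permutations" "HOL-Computational_Algebra.Polynomial"
begin

text \<open>
  Words are lists of natural numbers. As usual for these statistics, positions are counted from 1,
  whereas list indices start at 0; the \<open>i\<close>-th letter of \<open>w\<close> is \<^term>\<open>letter w i\<close>.
\<close>

abbreviation letter :: "nat list \<Rightarrow> nat \<Rightarrow> nat" where
  "letter w i \<equiv> w ! (i - 1)"

definition multiset_of_mults :: "nat \<Rightarrow> (nat \<Rightarrow> nat) \<Rightarrow> nat multiset" where
  "multiset_of_mults m k = (\<Sum>i = 1..m. replicate_mset (k i) i)"

definition tail_permutation :: "nat list \<Rightarrow> nat list" where
  "tail_permutation w =
     nths w {t. t < length w \<and> (\<forall>u. t < u \<and> u < length w \<longrightarrow> w ! u \<noteq> w ! t)}"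

definition words_with_tail :: "nat multiset \<Rightarrow> nat list \<Rightarrow> nat list set" where
  "words_with_tail M \<tau> = {w \<in> permutations_of_multiset M. tail_permutation w = \<tau>}"

definition consecutive :: "nat list \<Rightarrow> bool" where
  "consecutive \<tau> \<longleftrightarrow> (\<forall>i \<in> {1..length \<tau>}. \<exists>a b. set (take i \<tau>) = {a..b})"

definition INV :: "nat list \<Rightarrow> nat" where
  "INV w = card {(i, j). 1 \<le> i \<and> i < j \<and> j \<le> length w \<and> letter w i > letter w j}"

definition MAJ :: "nat list \<Rightarrow> nat" where
  "MAJ w = \<Sum> {i. 1 \<le> i \<and> i + 1 \<le> length w \<and> letter w i > letter w (i + 1)}"

definition MAJ_d :: "nat \<Rightarrow> nat list \<Rightarrow> nat" where
  "MAJ_d d w =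
     card {(i, j). 1 \<le> i \<and> i < j \<and> j < i + d \<and> j \<le> length w \<and> letter w i > letter w j}
     + \<Sum> {i. 1 \<le> i \<and> i + d \<le> length w \<and> letter w i > letter w (i + d)}"

text \<open>The statistic \<open>Z\<close> for words over the alphabet \<open>{1..m}\<close>.\<close>

definition Z :: "nat \<Rightarrow> nat list \<Rightarrow> nat" where
  "Z m w = (\<Sum>(i, j) \<in> {(i, j). 1 \<le> i \<and> i < j \<and> j \<le> m}. MAJ (filter (\<lambda>x. x = i \<or> x = j) w))"

definition gen_poly :: "(nat list \<Rightarrow> nat) \<Rightarrow> nat list set \<Rightarrow> int poly" where
  "gen_poly stat W = (\<Sum>w \<in> W. monom 1 (stat w))"

end

theory Submission
  imports Defs
begin

text \<open>
  The statistic \<open>MAJ\<^sub>d\<close> is carried to \<open>INV\<close> by Kadell's variant of Foata's second fundamental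
  transformation: when the letter \<open>x\<close> is appended, all but the last \<open>d - 1\<close> letters undergo Foata's
  block rotation, which keeps the relative order of the letters \<open>\<le> x\<close> and of the letters \<open>> x\<close>.
  Hence, for every interval \<open>I\<close> of letters, the last letter from \<open>I\<close> is unchanged: if \<open>x \<notin> I\<close>, then
  \<open>I\<close> lies on one side of \<open>x\<close>. A consecutive tail permutation is determined by these last letters,
  so the bijection preserves it; \<open>d = 1\<close> gives \<open>MAJ\<close>.

  For \<open>Z\<close>, deleting the last letter \<open>x\<close> of a word with tail \<open>\<tau>\<close> lowers \<open>Z\<close> by an amount that only
  depends on the new tail, in which \<open>x\<close> sits at some earlier position (or is absent). This recursion
  over all tails, consecutive or not, is solved by a product of q-binomial coefficients. For \<open>INV\<close>
  and a consecutive \<open>\<tau>\<close> the same product arises by deleting all copies of the last letter of \<open>\<tau>\<close>,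
  which is smaller or larger than all other letters.
\<close>

section \<open>Tail permutations, and the change of the statistics when a letter is appended\<close>

text \<open>\<open>remdups\<close> keeps the rightmost copy of each letter. Prefixing a letter
  shifts all indices by one, and index 0 is a tail position exactly when that letter does not
  recur.\<close>

lemma tail_permutation_eq_remdups: "tail_permutation w = remdups w"
proof (induction w)
  case Nil
  then show ?case by (simp add: tail_permutation_def)
next
  case (Cons x w)
  let ?T = "{t. t < length (x # w) \<and> (\<forall>u. t < u \<and> u < length (x # w) \<longrightarrow> (x # w) ! u \<noteq> (x # w) ! t)}"
  have 0: "0 \<in> ?T \<longleftrightarrow> x \<notin> set w"
    by (auto simp: in_set_conv_nth nth_Cons split: nat.splits)
  have S: "{j. Suc j \<in> ?T} = {t. t < length w \<and> (\<forall>u. t < u \<and> u < length w \<longrightarrow> w ! u \<noteq> w ! t)}"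
    by (auto simp: nth_Cons split: nat.splits)
  have "tail_permutation (x # w) = (if 0 \<in> ?T then [x] else []) @ nths w {j. Suc j \<in> ?T}"
    unfolding tail_permutation_def by (subst nths_Cons) simp
  then show ?case
    using 0 Cons.IH unfolding S tail_permutation_def by simp
qed

lemma remdups_snoc: "remdups (v @ [x]) = filter (\<lambda>a. a \<noteq> x) (remdups v) @ [x]"
  by (induction v) auto

lemma last_remdups: "w \<noteq> [] \<Longrightarrow> last (remdups w) = last w"
  by (cases w rule: rev_cases) (simp_all add: remdups_snoc)

text \<open>Only pairs ending at the new position are added. Those at distance less than
  \<open>d\<close> start among the last \<open>d - 1\<close> letters of \<open>v\<close>; the one at
  distance exactly \<open>d\<close> starts at position \<open>length v - d + 1\<close>, counted from
  1, which is list index \<open>length v - d\<close>.\<close>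

lemma MAJ_d_snoc:
  assumes "d \<ge> 1"
  shows "MAJ_d d (v @ [x]) =
    MAJ_d d v + length (filter (\<lambda>a. a > x) (drop (length v - (d - 1)) v))
      + (if d \<le> length v \<and> v ! (length v - d) > x then length v - d + 1 else 0)"
proof -
  let ?n = "length v"
  let ?P = "\<lambda>w. {(i, j). 1 \<le> i \<and> i < j \<and> j < i + d \<and> j \<le> length w \<and> letter w i > letter w j}"
  let ?D = "\<lambda>w. {i. 1 \<le> i \<and> i + d \<le> length w \<and> letter w i > letter w (i + d)}"
  \<comment> \<open>Truncated subtraction gives 0 when \<open>v\<close> has fewer than
    \<open>d - 1\<close> letters, so \<open>drop ?e v\<close> is then all of
    \<open>v\<close>.\<close>
  let ?e = "?n - (d - 1)"
  let ?I = "{i. i < length (drop ?e v) \<and> drop ?e v ! i > x}"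
  let ?f = "\<lambda>i. (?e + i + 1, ?n + 1)"
  have fin: "finite (?P w)" for w :: "nat list"
    by (rule finite_subset[of _ "{..length w} \<times> {..length w}"]) auto
  have finD: "finite (?D w)" for w :: "nat list"
    by (rule finite_subset[of _ "{..length w}"]) auto
  have P: "?P (v @ [x]) = ?P v \<union> ?f ` ?I"
  proof (intro set_eqI iffI)
    fix p assume "p \<in> ?P (v @ [x])"
    then obtain i j where p: "p = (i, j)" "1 \<le> i" "i < j" "j < i + d" "j \<le> ?n + 1"
      "letter (v @ [x]) i > letter (v @ [x]) j" by auto
    show "p \<in> ?P v \<union> ?f ` ?I"
    proof (cases "j = ?n + 1")
      case True
      then have "v ! (i - 1) > x" using p by (auto simp: nth_append_left)
      then have "i - 1 - ?e \<in> ?I" "p = ?f (i - 1 - ?e)"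
        using p True by auto
      then show ?thesis by blast
    next
      case False
      then have "j - 1 < ?n" "i - 1 < ?n" using p by auto
      then show ?thesis using p by (auto simp: nth_append)
    qed
  next
    fix p assume "p \<in> ?P v \<union> ?f ` ?I"
    then show "p \<in> ?P (v @ [x])"
      using assms by (auto simp: nth_append)
  qed
  have cP: "card (?P (v @ [x])) = card (?P v) + length (filter (\<lambda>a. a > x) (drop ?e v))"
  proof -
    have "card (?P (v @ [x])) = card (?P v) + card (?f ` ?I)"
      unfolding P by (rule card_Un_disjoint) (use fin[of v] in auto)
    also have "card (?f ` ?I) = card ?I" by (rule card_image) (auto simp: inj_on_def)
    finally show ?thesis by (simp only: length_filter_conv_card)
  qed
  have D: "?D (v @ [x]) = ?D v \<union> (if d \<le> ?n \<and> v ! (?n - d) > x then {?n - d + 1} else {})"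
  proof (intro set_eqI iffI)
    fix i assume i: "i \<in> ?D (v @ [x])"
    show "i \<in> ?D v \<union> (if d \<le> ?n \<and> v ! (?n - d) > x then {?n - d + 1} else {})"
    proof (cases "i + d = ?n + 1")
      case True
      then have "i - 1 = ?n - d" "d \<le> ?n" "i = ?n - d + 1" using i by auto
      moreover from this have "v ! (i - 1) > x" using i True assms by (auto simp: nth_append)
      ultimately show ?thesis by simp
    next
      case False
      then have "i + d - 1 < ?n" "i - 1 < ?n" using i assms by auto
      then show ?thesis using i by (auto simp: nth_append)
    qed
  next
    fix i assume i: "i \<in> ?D v \<union> (if d \<le> ?n \<and> v ! (?n - d) > x then {?n - d + 1} else {})"
    then show "i \<in> ?D (v @ [x])"
      using assms by (auto simp: nth_append split: if_splits)
  qed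
  have "\<Sum> (?D (v @ [x])) = \<Sum> (?D v) + (if d \<le> ?n \<and> v ! (?n - d) > x then ?n - d + 1 else 0)"
    unfolding D by (subst sum.union_disjoint) (use finD[of v] in auto)
  then show ?thesis using cP unfolding MAJ_d_def by linarith
qed

lemma MAJ_d_Nil [simp]: "MAJ_d d [] = 0"
proof -
  have 1: "{(i :: nat, j). 1 \<le> i \<and> i < j \<and> j < i + d \<and> j \<le> length [] \<and> P i j} = {}" for P by auto
  have 2: "{i :: nat. 1 \<le> i \<and> i + d \<le> length [] \<and> P i} = {}" for P by auto
  show ?thesis unfolding MAJ_d_def 1 2 by simp
qed

text \<open>A window at least as long as the word catches every pair and leaves no pair at distance
  \<open>d\<close>. The recursion for \<open>INV\<close> thus comes from the one for
  \<open>MAJ_d\<close>.\<close>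

lemma INV_eq_MAJ_d: "length w \<le> d \<Longrightarrow> INV w = MAJ_d d w"
proof -
  assume d: "length w \<le> d"
  have 1: "{(i, j). 1 \<le> i \<and> i < j \<and> j < i + d \<and> j \<le> length w \<and> letter w i > letter w j}
      = {(i, j). 1 \<le> i \<and> i < j \<and> j \<le> length w \<and> letter w i > letter w j}"
    using d by auto
  have 2: "{i. 1 \<le> i \<and> i + d \<le> length w \<and> letter w i > letter w (i + d)} = {}"
    using d by auto
  show ?thesis unfolding MAJ_d_def INV_def 1 2 by simp
qed

lemma MAJ_eq_MAJ_d: "MAJ = MAJ_d 1"
proof
  fix w
  have "{(i, j). 1 \<le> i \<and> i < j \<and> j < i + (1::nat) \<and> j \<le> length w \<and> letter w i > letter w j} = {}"
    by auto
  then show "MAJ w = MAJ_d 1 w" unfolding MAJ_def MAJ_d_def by (simp only: card.empty add_0)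
qed

lemma MAJ_Nil [simp]: "MAJ [] = 0"
  by (simp add: MAJ_eq_MAJ_d)

lemma MAJ_snoc:
  "MAJ (v @ [x]) = MAJ v + (if v \<noteq> [] \<and> last v > x then length v else 0)"
  unfolding MAJ_eq_MAJ_d by (subst MAJ_d_snoc) (auto simp: last_conv_nth Suc_le_eq)

lemma INV_Nil [simp]: "INV [] = 0"
  by (simp add: INV_eq_MAJ_d[of _ 0])

lemma INV_snoc: "INV (v @ [x]) = INV v + length (filter (\<lambda>a. a > x) v)"
proof -
  let ?d = "length v + 1"
  have "INV (v @ [x]) = MAJ_d ?d (v @ [x])" by (rule INV_eq_MAJ_d) simp
  also have "\<dots> = MAJ_d ?d v + length (filter (\<lambda>a. a > x) v)"
    by (subst MAJ_d_snoc) auto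
  also have "MAJ_d ?d v = INV v" by (rule INV_eq_MAJ_d[symmetric]) simp
  finally show ?thesis .
qed

text \<open>Defined on multisets, since rearranging within either factor of a concatenation leaves
  the inversions between the factors unchanged.\<close>

definition cross_inv :: "nat multiset \<Rightarrow> nat multiset \<Rightarrow> nat" where
  "cross_inv A B = (\<Sum>b\<in>#B. size (filter_mset (\<lambda>a. a > b) A))"

lemma length_filter_eq_size: "length (filter P xs) = size (filter_mset P (mset xs))"
  by (metis mset_filter size_mset)

lemma INV_append: "INV (A @ B) = INV A + INV B + cross_inv (mset A) (mset B)"
proof (induction B rule: rev_induct)
  case Nil
  then show ?case by (simp add: cross_inv_def)
next
  case (snoc b B)
  have "INV (A @ B @ [b]) = INV (A @ B) + length (filter (\<lambda>a. a > b) (A @ B))"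
    using INV_snoc[of "A @ B" b] by simp
  then show ?case
    using snoc by (simp add: INV_snoc cross_inv_def length_filter_eq_size)
qed

subsection \<open>Foata's block rotation and Kadell's bijection\<close>

text \<open>
  The word is cut after each letter satisfying \<open>P\<close>, and the last letter of each block moves to its
  front; \<open>acc\<close> is the part of the current block already read.
\<close>

fun rotate_blocks :: "('a \<Rightarrow> bool) \<Rightarrow> 'a list \<Rightarrow> 'a list \<Rightarrow> 'a list" where
  "rotate_blocks P acc [] = acc"
| "rotate_blocks P acc (a # y) =
    (if P a then a # acc @ rotate_blocks P [] y else rotate_blocks P (acc @ [a]) y)"

text \<open>\<open>h\<close> is the head of the current rotated block, held back until the block ends.\<close>

fun unrotate_blocks :: "('a \<Rightarrow> bool) \<Rightarrow> 'a \<Rightarrow> 'a list \<Rightarrow> 'a list" where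
  "unrotate_blocks P h [] = [h]"
| "unrotate_blocks P h (b # u) =
    (if P b then h # unrotate_blocks P b u else b # unrotate_blocks P h u)"

lemma mset_rotate_blocks [simp]: "mset (rotate_blocks P acc y) = mset acc + mset y"
  by (induction P acc y rule: rotate_blocks.induct) auto

lemma length_rotate_blocks [simp]: "length (rotate_blocks P acc y) = length acc + length y"
  by (metis mset_rotate_blocks size_mset size_union)

text \<open>A rotation only moves a letter satisfying \<open>P\<close> past letters that do not.
  Letters on the same side of \<open>P\<close> therefore keep their relative order.\<close>

lemma filter_rotate_blocks:
  assumes "\<forall>a \<in> set acc. \<not> P a" "(\<forall>a. Q a \<longrightarrow> P a) \<or> (\<forall>a. Q a \<longrightarrow> \<not> P a)"
  shows "filter Q (rotate_blocks P acc y) = filter Q (acc @ y)"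
  using assms
proof (induction P acc y rule: rotate_blocks.induct)
  case (2 P acc a y)
  have "filter Q acc = [] \<or> \<not> P a \<or> \<not> Q a"
    using 2(3,4) by (auto simp: filter_empty_conv)
  then show ?case using 2 by auto
qed auto

lemma unrotate_blocks_append:
  "\<forall>a \<in> set acc. \<not> P a \<Longrightarrow> unrotate_blocks P h (acc @ u) = acc @ unrotate_blocks P h u"
  by (induction acc) auto

text \<open>If the last letter satisfies \<open>P\<close>, every block is complete, so after the
  rotation the letters satisfying \<open>P\<close> are exactly the block heads and the blocks can be
  read off.\<close>

lemma unrotate_rotate_blocks:
  assumes "\<forall>a \<in> set acc. \<not> P a" "y \<noteq> []" "P (last y)"
  shows "\<exists>a u. rotate_blocks P acc y = a # u \<and> P a \<and> unrotate_blocks P a u = acc @ y"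
  using assms
proof (induction P acc y rule: rotate_blocks.induct)
  case (2 P acc a y)
  show ?case
  proof (cases "P a")
    case True
    show ?thesis
    proof (cases "y = []")
      case True
      then show ?thesis using 2 \<open>P a\<close> unrotate_blocks_append[of acc P a "[]"] by simp
    next
      case False
      then obtain b u where "rotate_blocks P [] y = b # u" "P b" "unrotate_blocks P b u = y"
        using 2 True by auto
      then show ?thesis using True 2 by (simp add: unrotate_blocks_append)
    qed
  next
    case False
    then have "y \<noteq> []" using 2(4,5) by auto
    then show ?thesis using 2 False by auto
  qed
qed auto

text \<open>A block consists of letters \<open>> x\<close> followed by one letter
  \<open><= x\<close>; moving the latter to the front destroys one inversion per letter
  \<open>> x\<close> in the block. Inversions between blocks stay, and since the last letter is
  \<open><= x\<close>, every letter \<open>> x\<close> lies in a complete block.\<close>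

lemma INV_rotate_le:
  assumes "\<forall>a \<in> set acc. a > x" "y = [] \<longrightarrow> acc = []" "y \<noteq> [] \<longrightarrow> last y \<le> x"
  shows "INV (rotate_blocks (\<lambda>a. a \<le> x) acc y) + length (filter (\<lambda>a. a > x) (acc @ y)) = INV (acc @ y)"
  using assms
proof (induction "\<lambda>a. a \<le> x" acc y rule: rotate_blocks.induct)
  case (1 acc)
  then show ?case by simp
next
  case (2 acc a y)
  show ?case
  proof (cases "a \<le> x")
    case True
    have IH: "INV (rotate_blocks (\<lambda>a. a \<le> x) [] y) + length (filter (\<lambda>a. a > x) y) = INV y"
      using 2(1)[OF True] 2(5) by (cases "y = []") auto
    have 1: "filter (\<lambda>b. b > a) acc = acc" "filter (\<lambda>b. b > x) acc = acc"
      using 2(3) True by (auto intro!: filter_True)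
    have 2: "filter_mset (\<lambda>a'. b < a') {#a#} = {#}" if "b \<in> set acc" for b
      using 2(3) True that by (auto simp: not_less intro: less_imp_le order_trans)
    then have "cross_inv {#a#} (mset acc) = 0"
      by (auto simp: cross_inv_def)
    moreover have "cross_inv (mset acc) {#a#} = length acc"
      unfolding cross_inv_def using 1 by (simp flip: mset_filter)
    ultimately have "INV (a # acc) + length acc = INV (acc @ [a])"
      using INV_append[of "[a]" acc] INV_append[of acc "[a]"] by simp
    then show ?thesis
      using True IH 1 INV_append[of "a # acc" "rotate_blocks (\<lambda>a. a \<le> x) [] y"]
        INV_append[of "acc @ [a]" y] by simp
  next
    case False
    then have "y \<noteq> []" using 2(5) by auto
    then show ?thesis using 2(2)[OF False] 2(3-) False by simp
  qed
qed

text \<open>The mirror case: a letter \<open>> x\<close> jumps over the letters \<open><= x\<close>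
  of its block and creates one inversion with each of them.\<close>

lemma INV_rotate_gt:
  assumes "\<forall>a \<in> set acc. a \<le> x" "y = [] \<longrightarrow> acc = []" "y \<noteq> [] \<longrightarrow> last y > x"
  shows "INV (rotate_blocks (\<lambda>a. a > x) acc y) = INV (acc @ y) + length (filter (\<lambda>a. a \<le> x) (acc @ y))"
  using assms
proof (induction "\<lambda>a. a > x" acc y rule: rotate_blocks.induct)
  case (1 acc)
  then show ?case by simp
next
  case (2 acc a y)
  show ?case
  proof (cases "a > x")
    case True
    have IH: "INV (rotate_blocks (\<lambda>a. a > x) [] y) = INV y + length (filter (\<lambda>a. a \<le> x) y)"
      using 2(1)[OF True] 2(5) by (cases "y = []") auto
    have 1: "filter (\<lambda>b. b > a) acc = []" "filter (\<lambda>b. b \<le> x) acc = acc"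
      using 2(3) True by (auto intro!: filter_True simp: filter_empty_conv)
    have 2: "filter_mset (\<lambda>a'. b < a') {#a#} = {#a#}" if "b \<in> set acc" for b
      using 2(3) True that by (auto intro: le_less_trans)
    then have "(\<Sum>b\<in>#mset acc. size (filter_mset (\<lambda>a'. b < a') {#a#})) = (\<Sum>b\<in>#mset acc. 1)"
      by (intro arg_cong[where f = sum_mset] image_mset_cong) auto
    then have "cross_inv {#a#} (mset acc) = length acc"
      by (simp add: cross_inv_def)
    moreover have "cross_inv (mset acc) {#a#} = 0"
      unfolding cross_inv_def using 1 by (simp flip: mset_filter)
    ultimately have "INV (a # acc) = INV (acc @ [a]) + length acc"
      using INV_append[of "[a]" acc] INV_append[of acc "[a]"] by simp
    then show ?thesis
      using True IH 1 INV_append[of "a # acc" "rotate_blocks (\<lambda>a. a > x) [] y"]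
        INV_append[of "acc @ [a]" y] by simp
  next
    case False
    then have "y \<noteq> []" using 2(5) by auto
    then show ?thesis using 2(2)[OF False] 2(3-) False by simp
  qed
qed

text \<open>Letting the last letter choose the rule ensures that the final block is
  complete.\<close>

definition foata_rotate :: "nat \<Rightarrow> nat list \<Rightarrow> nat list" where
  "foata_rotate x y =
    (if last y \<le> x then rotate_blocks (\<lambda>a. a \<le> x) [] y else rotate_blocks (\<lambda>a. a > x) [] y)"

lemma mset_foata_rotate [simp]: "mset (foata_rotate x y) = mset y"
  by (simp add: foata_rotate_def)

lemma length_foata_rotate [simp]: "length (foata_rotate x y) = length y"
  by (simp add: foata_rotate_def)

lemma filter_foata_rotate:
  assumes "(\<forall>a. Q a \<longrightarrow> a \<le> x) \<or> (\<forall>a. Q a \<longrightarrow> a > x)"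
  shows "filter Q (foata_rotate x y) = filter Q y"
proof -
  have "(\<forall>a. Q a \<longrightarrow> a \<le> x) \<or> (\<forall>a. Q a \<longrightarrow> \<not> a \<le> x)"
    using assms by (auto simp: not_le)
  then show ?thesis
    unfolding foata_rotate_def by (auto simp: filter_rotate_blocks not_le[symmetric])
qed

text \<open>The second summand on the left counts the inversions that a subsequently appended
  \<open>x\<close> makes with \<open>y\<close>. Rotation and appending together thus add
  \<open>length y\<close> at a descent and 0 otherwise, which is the increment of a major
  index.\<close>

lemma INV_foata_rotate:
  assumes "y \<noteq> []"
  shows "INV (foata_rotate x y) + length (filter (\<lambda>a. a > x) y) =
    INV y + (if last y > x then length y else 0)"
proof (cases "last y \<le> x")
  case True
  then show ?thesis
    using INV_rotate_le[of "[]" x y] assms by (simp add: foata_rotate_def)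
next
  case False
  then show ?thesis
    using INV_rotate_gt[of "[]" x y] assms sum_length_filter_compl[of "\<lambda>a. a > x" y]
    by (simp add: foata_rotate_def not_less)
qed

text \<open>The first letter of the image lies on the same side of \<open>x\<close> as the last
  letter of \<open>y\<close>, so it reveals which rule to undo.\<close>

lemma inj_foata_rotate: "inj_on (foata_rotate x) {y. y \<noteq> []}"
proof (rule inj_on_inverseI)
  fix y :: "nat list" assume "y \<in> {y. y \<noteq> []}"
  then have y: "y \<noteq> []" by simp
  show "(\<lambda>z. if hd z \<le> x then unrotate_blocks (\<lambda>a. a \<le> x) (hd z) (tl z)
      else unrotate_blocks (\<lambda>a. a > x) (hd z) (tl z)) (foata_rotate x y) = y"
  proof (cases "last y \<le> x")
    case True
    then show ?thesis
      using unrotate_rotate_blocks[of "[]" "\<lambda>a. a \<le> x" y] y by (auto simp: foata_rotate_def)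
  next
    case False
    then show ?thesis
      using unrotate_rotate_blocks[of "[]" "\<lambda>a. a > x" y] y by (auto simp: foata_rotate_def)
  qed
qed

text \<open>In the first branch no letter lies at distance \<open>d\<close> from the new
  \<open>x\<close>, so \<open>INV\<close> and \<open>MAJ_d\<close> grow by the same amount and no
  correction is made.\<close>

definition kadell_step :: "nat \<Rightarrow> nat \<Rightarrow> nat list \<Rightarrow> nat list" where
  "kadell_step d x u =
    (if length u < d then u @ [x]
     else foata_rotate x (take (length u - (d - 1)) u) @ drop (length u - (d - 1)) u @ [x])"

definition kadell :: "nat \<Rightarrow> nat list \<Rightarrow> nat list" where
  "kadell d w = fold (kadell_step d) w []"

lemma kadell_Nil [simp]: "kadell d [] = []"
  by (simp add: kadell_def)

lemma kadell_snoc: "kadell d (v @ [x]) = kadell_step d x (kadell d v)"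
  by (simp add: kadell_def)

lemma mset_kadell_step: "mset (kadell_step d x u) = mset (u @ [x])"
proof -
  have "mset (take n u) + mset (drop n u) = mset u" for n
    by (metis append_take_drop_id mset_append)
  then show ?thesis by (simp add: kadell_step_def)
qed

lemma mset_kadell [simp]: "mset (kadell d w) = mset w"
  by (induction w rule: rev_induct) (simp_all add: kadell_snoc mset_kadell_step)

lemma length_kadell [simp]: "length (kadell d w) = length w"
  by (metis mset_kadell size_mset)

text \<open>Each step rotates only letters that end up outside the last \<open>d\<close> places. The
  next comparison at distance \<open>d\<close> therefore sees the original letter.\<close>

lemma drop_kadell: "drop (length w - d) (kadell d w) = drop (length w - d) w"
proof (induction w rule: rev_induct)
  case (snoc x v)
  show ?case
  proof (cases "length v < d")
    case True
    then show ?thesis using snoc by (simp add: kadell_snoc kadell_step_def)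
  next
    case False
    show ?thesis
    proof (cases d)
      case 0
      then show ?thesis
        using length_kadell[of d "v @ [x]"] by simp
    next
      case (Suc e)
      let ?n = "length v"
      have "drop (?n - e) (kadell d v) = drop (?n - e) v"
      proof -
        have "drop 1 (drop (?n - d) (kadell d v)) = drop 1 (drop (?n - d) v)"
          using snoc by simp
        then show ?thesis using False Suc by (simp add: Suc_diff_Suc Suc_diff_le)
      qed
      then show ?thesis
        using False Suc by (simp add: kadell_snoc kadell_step_def)
    qed
  qed
qed simp

lemma INV_kadell:
  assumes "d \<ge> 1"
  shows "INV (kadell d w) = MAJ_d d w"
proof (induction w rule: rev_induct)
  case (snoc x v)
  let ?n = "length v"
  let ?u = "kadell d v"
  show ?case
  proof (cases "?n < d")
    case True
    have "length (filter (\<lambda>a. a > x) ?u) = length (filter (\<lambda>a. a > x) v)"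
      by (simp add: length_filter_eq_size)
    then show ?thesis
      using True snoc MAJ_d_snoc[OF assms, of v x] by (simp add: kadell_snoc kadell_step_def INV_snoc)
  next
    case False
    let ?k = "?n - (d - 1)"
    let ?y = "take ?k ?u" and ?s = "drop ?k ?u"
    have y: "length ?y = ?n - d + 1" "?y \<noteq> []"
      using False assms length_kadell[of d v] by (auto simp del: length_kadell)
    \<comment> \<open>The letter at distance \<open>d\<close> before the new \<open>x\<close> is the
      last letter of the rotated prefix, and it agrees with the corresponding letter of
      \<open>v\<close>.\<close>
    have "last ?y = ?u ! (?n - d)"
      using y False assms by (simp add: last_conv_nth)
    also have "\<dots> = drop (?n - d) ?u ! 0" using False by simp
    also have "\<dots> = v ! (?n - d)"
      unfolding drop_kadell using False assms by simp
    finally have l: "last ?y = v ! (?n - d)" .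
    have s: "?s = drop ?k v"
    proof -
      have "drop 1 (drop (?n - d) ?u) = drop 1 (drop (?n - d) v)"
        using drop_kadell by simp
      moreover have "?k = ?n - d + 1" using False assms by simp
      ultimately show ?thesis by simp
    qed
    have "INV (kadell d (v @ [x])) = INV (foata_rotate x ?y @ ?s) + length (filter (\<lambda>a. a > x) (foata_rotate x ?y @ ?s))"
      using False INV_snoc[of "foata_rotate x ?y @ ?s"] by (simp add: kadell_snoc kadell_step_def)
    also have "length (filter (\<lambda>a. a > x) (foata_rotate x ?y @ ?s)) =
        length (filter (\<lambda>a. a > x) ?y) + length (filter (\<lambda>a. a > x) ?s)"
      by (simp add: length_filter_eq_size)
    also have "INV (foata_rotate x ?y @ ?s) = INV (foata_rotate x ?y) + INV ?s + cross_inv (mset ?y) (mset ?s)"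
      by (simp add: INV_append)
    finally have 1: "INV (kadell d (v @ [x])) = INV (foata_rotate x ?y) + INV ?s + cross_inv (mset ?y) (mset ?s)
       + (length (filter (\<lambda>a. a > x) ?y) + length (filter (\<lambda>a. a > x) ?s))" .
    define D where "D = (if last ?y > x then length ?y else 0)"
    have 2: "INV (foata_rotate x ?y) + length (filter (\<lambda>a. a > x) ?y) = INV ?y + D"
      unfolding D_def by (rule INV_foata_rotate[OF y(2)])
    have 3: "MAJ_d d v = INV ?y + INV ?s + cross_inv (mset ?y) (mset ?s)"
      using snoc INV_append[of ?y ?s] by simp
    have 4: "D = (if d \<le> ?n \<and> v ! (?n - d) > x then ?n - d + 1 else 0)"
      using False unfolding D_def l y(1) by simp
    show ?thesis
      unfolding MAJ_d_snoc[OF assms] 4[symmetric] s[symmetric] using 1 2 3 by linarith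
  qed
qed simp

lemma kadell_step_inject:
  assumes "d \<ge> 1" "kadell_step d x u = kadell_step d x' u'"
  shows "x = x' \<and> u = u'"
proof -
  have len: "length u = length u'"
    using arg_cong[OF assms(2), of "\<lambda>w. size (mset w)"] unfolding mset_kadell_step by simp
  show ?thesis
  proof (cases "length u < d")
    case True
    then show ?thesis using assms len by (simp add: kadell_step_def)
  next
    case False
    let ?k = "length u - (d - 1)"
    have "x = x'" and f: "foata_rotate x (take ?k u) = foata_rotate x' (take ?k u')"
      and d: "drop ?k u = drop ?k u'"
      using assms(2) False len by (auto simp: kadell_step_def)
    moreover have "take ?k u \<noteq> []" "take ?k u' \<noteq> []" using False assms(1) len by auto
    ultimately have "take ?k u = take ?k u'"
      using inj_onD[OF inj_foata_rotate] by auto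
    with d \<open>x = x'\<close> show ?thesis by (metis append_take_drop_id)
  qed
qed

lemma inj_kadell:
  assumes "d \<ge> 1"
  shows "inj (kadell d)"
proof (rule injI)
  show "v = w" if "kadell d v = kadell d w" for v w
    using that
  proof (induction v arbitrary: w rule: rev_induct)
    case Nil
    then show ?case using length_kadell[of d w] by simp
  next
    case (snoc x v)
    show ?case
    proof (cases w rule: rev_cases)
      case Nil
      then show ?thesis using snoc(2) length_kadell[of d "v @ [x]"] by simp
    next
      case w: (snoc w' y)
      have "x = y \<and> kadell d v = kadell d w'"
        using snoc.prems unfolding w kadell_snoc by (rule kadell_step_inject[OF assms])
      then show ?thesis using snoc.IH w by simp
    qed
  qed
qed

section \<open>Preservation of consecutive tails under Kadell's bijection\<close>

text \<open>Equality of the multisets makes the two filtered words empty simultaneously, so the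
  unspecified value \<open>last []\<close> is only ever compared with itself.\<close>

definition same_interval_last :: "nat list \<Rightarrow> nat list \<Rightarrow> bool" where
  "same_interval_last v w \<longleftrightarrow> mset v = mset w \<and>
     (\<forall>a b. last (filter (\<lambda>x. x \<in> {a..b}) v) = last (filter (\<lambda>x. x \<in> {a..b}) w))"

lemma same_interval_last_kadell: "same_interval_last (kadell d w) w"
proof -
  have "last (filter (\<lambda>x. x \<in> {a..b}) (kadell d w)) = last (filter (\<lambda>x. x \<in> {a..b}) w)" for a b
  proof (induction w rule: rev_induct)
    case (snoc y v)
    let ?u = "kadell d v"
    let ?Q = "\<lambda>x. x \<in> {a..b}"
    show ?case
    proof (cases "?Q y")
      case True
      then show ?thesis by (simp add: kadell_snoc kadell_step_def)
    next
      case False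
      then have "(\<forall>x. ?Q x \<longrightarrow> x \<le> y) \<or> (\<forall>x. ?Q x \<longrightarrow> x > y)" by auto
      then have "filter ?Q (foata_rotate y (take n ?u) @ drop n ?u) = filter ?Q ?u" for n
        by (metis append_take_drop_id filter_append filter_foata_rotate)
      then have "filter ?Q (kadell d (v @ [y])) = filter ?Q ?u"
        using False by (auto simp: kadell_snoc kadell_step_def)
      then show ?thesis using snoc False by simp
    qed
  qed simp
  then show ?thesis by (simp add: same_interval_last_def)
qed

text \<open>The intersection of two intervals is an interval. This allows restricting both words to
  the letters of a shorter tail.\<close>

lemma same_interval_last_filter:
  assumes "same_interval_last v w"
  shows "same_interval_last (filter (\<lambda>x. x \<in> {a..b}) v) (filter (\<lambda>x. x \<in> {a..b}) w)"
proof -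
  have "filter (\<lambda>x. x \<in> {c..d}) (filter (\<lambda>x. x \<in> {a..b}) u) =
    filter (\<lambda>x. x \<in> {max c a..min d b}) u" for c d u
    by (auto intro!: filter_cong)
  then show ?thesis using assms by (simp only: same_interval_last_def mset_filter) auto
qed

lemma consecutive_snoc:
  "consecutive (\<tau> @ [x]) \<longleftrightarrow> consecutive \<tau> \<and> (\<exists>a b. insert x (set \<tau>) = {a..b})"
proof
  assume c: "consecutive (\<tau> @ [x])"
  have "\<exists>a b. set (take i \<tau>) = {a..b}" if "i \<in> {1..length \<tau>}" for i
    using bspec[OF c[unfolded consecutive_def], of i] that by auto
  moreover have "\<exists>a b. insert x (set \<tau>) = {a..b}"
    using bspec[OF c[unfolded consecutive_def], of "length \<tau> + 1"] by auto
  ultimately show "consecutive \<tau> \<and> (\<exists>a b. insert x (set \<tau>) = {a..b})"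
    by (simp add: consecutive_def)
next
  assume c: "consecutive \<tau> \<and> (\<exists>a b. insert x (set \<tau>) = {a..b})"
  show "consecutive (\<tau> @ [x])"
    unfolding consecutive_def
  proof
    fix i assume i: "i \<in> {1..length (\<tau> @ [x])}"
    show "\<exists>a b. set (take i (\<tau> @ [x])) = {a..b}"
    proof (cases "i \<le> length \<tau>")
      case True
      then show ?thesis using c i by (simp add: consecutive_def)
    next
      case False
      then have "i = length \<tau> + 1" using i by auto
      then show ?thesis using c by simp
    qed
  qed
qed

lemma consecutive_interval: "consecutive \<tau> \<Longrightarrow> \<exists>a b. set \<tau> = {a..b}"
proof (cases \<tau> rule: rev_cases)
  case Nil
  then have "set \<tau> = {1..0}" by simp
  then show ?thesis by blast
qed (auto simp: consecutive_snoc)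

text \<open>All letters together form an interval, so both words end in the same letter
  \<open>x\<close>. The remaining tail letters form an interval again, and the induction hypothesis
  applies to both words with \<open>x\<close> deleted.\<close>

lemma remdups_same_interval_last:
  assumes "consecutive \<tau>" "same_interval_last v w" "remdups w = \<tau>"
  shows "remdups v = \<tau>"
  using assms
proof (induction \<tau> arbitrary: v w rule: rev_induct)
  case Nil
  then show ?case by (auto simp: same_interval_last_def)
next
  case (snoc x \<tau>)
  obtain a b where ab: "set \<tau> = {a..b}"
    using consecutive_interval snoc.prems(1) consecutive_snoc by blast
  obtain c d where cd: "insert x (set \<tau>) = {c..d}"
    using snoc.prems(1) consecutive_snoc by blast
  have w: "w \<noteq> []" "set w = insert x (set \<tau>)" "x \<notin> set \<tau>"
    using snoc.prems(3) set_remdups[of w] distinct_remdups[of w] by auto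
  have v: "set v = set w" "v \<noteq> []"
    using snoc.prems(2) w(1) mset_eq_setD unfolding same_interval_last_def by auto
  have full: "filter (\<lambda>y. y \<in> {c..d}) v = v" "filter (\<lambda>y. y \<in> {c..d}) w = w"
    using v w cd by (auto intro!: filter_True)
  have "last v = last w"
    using snoc.prems(2) full unfolding same_interval_last_def by metis
  also have "\<dots> = x"
    using last_remdups[OF w(1)] snoc.prems(3) by simp
  finally obtain v' where v': "v = v' @ [x]" by (metis append_butlast_last_id v(2))
  let ?F = "filter (\<lambda>y. y \<in> {a..b})"
  have "remdups (?F w) = ?F (remdups w)" by (rule remdups_filter)
  also have "\<dots> = \<tau>"
    using snoc.prems(3) w(3) ab by (auto intro!: filter_True)
  finally have "remdups (?F v) = \<tau>"
    using snoc.IH[OF _ same_interval_last_filter[OF snoc.prems(2)]] snoc.prems(1) consecutive_snoc by blast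
  then have 1: "?F (remdups v) = \<tau>" by (simp add: remdups_filter)
  have "?F (remdups v) = filter (\<lambda>a. a \<noteq> x) (remdups v)"
    using v w ab by (auto intro!: filter_cong)
  also have "\<dots> = filter (\<lambda>a. a \<noteq> x) (remdups v')" by (simp add: v' remdups_snoc)
  finally show ?case using 1 by (simp add: v' remdups_snoc)
qed

text \<open>An injective self-map of a finite set is a bijection, so it suffices that
  \<open>kadell d\<close> preserves the tail; surjectivity comes for free.\<close>

lemma gen_poly_INV_MAJ_d:
  assumes "d \<ge> 1" "consecutive \<tau>"
  shows "gen_poly INV (words_with_tail M \<tau>) = gen_poly (MAJ_d d) (words_with_tail M \<tau>)"
proof -
  let ?W = "words_with_tail M \<tau>"
  have inj: "inj_on (kadell d) ?W"
    using inj_kadell[OF assms(1)] by (rule inj_on_subset) simp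
  have "kadell d ` ?W \<subseteq> ?W"
    using remdups_same_interval_last[OF assms(2) same_interval_last_kadell]
    by (auto simp: words_with_tail_def tail_permutation_eq_remdups permutations_of_multiset_def)
  moreover have "finite ?W" by (simp add: words_with_tail_def)
  ultimately have "kadell d ` ?W = ?W"
    using inj by (intro endo_inj_surj)
  then have "gen_poly INV ?W = (\<Sum>w\<in>kadell d ` ?W. monom 1 (INV w))"
    by (simp add: gen_poly_def)
  also have "\<dots> = gen_poly (MAJ_d d) ?W"
    using inj by (simp add: sum.reindex INV_kadell[OF assms(1)] gen_poly_def)
  finally show ?thesis .
qed

subsection \<open>Inversions and insertions of an extreme letter\<close>

text \<open>The factor \<open>(q - 1) ^ n\<close> of the usual q-factorial is kept, as it cancels in the q-binomial.\<close>

primrec qfact :: "real \<Rightarrow> nat \<Rightarrow> real" where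
  "qfact q 0 = 1"
| "qfact q (Suc n) = (q ^ Suc n - 1) * qfact q n"

text \<open>The q-binomial coefficient of \<open>a + b\<close> over \<open>a\<close>, which is symmetric in this indexing.\<close>

definition qbinom :: "real \<Rightarrow> nat \<Rightarrow> nat \<Rightarrow> real" where
  "qbinom q a b = qfact q (a + b) / (qfact q a * qfact q b)"

lemma qfact_nonzero: "q > 1 \<Longrightarrow> qfact q n \<noteq> 0"
proof (induction n)
  case (Suc n)
  have "1 < q ^ Suc n" by (rule one_less_power) (use Suc in simp_all)
  then have "q ^ Suc n - 1 \<noteq> 0" by linarith
  then show ?case using Suc by simp
qed simp

lemma qbinom_commute: "qbinom q a b = qbinom q b a"
  by (simp add: qbinom_def ac_simps)

lemma qbinom_0 [simp]:
  assumes "q > 1"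
  shows "qbinom q 0 n = 1" "qbinom q n 0 = 1"
  using qfact_nonzero[OF assms] by (simp_all add: qbinom_def)

text \<open>A q-Pascal rule. With \<open>s = q ^ Suc a\<close> and \<open>t = q ^ Suc b\<close>,
  clearing denominators reduces it to \<open>s * t - 1 = (s - 1) + s * (t - 1)\<close>.\<close>

lemma qbinom_Suc:
  assumes "q > 1"
  shows "qbinom q (Suc a) (Suc b) = qbinom q a (Suc b) + q ^ Suc a * qbinom q (Suc a) b"
proof -
  have nz: "q ^ Suc n - 1 \<noteq> 0" for n
    using one_less_power[OF assms, of "Suc n"] by (simp del: power_Suc)
  define s t where "s = q ^ Suc a" and "t = q ^ Suc b"
  have st: "s - 1 \<noteq> 0" "t - 1 \<noteq> 0" using nz by (auto simp: s_def t_def simp del: power_Suc)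
  have pow: "q ^ (Suc (Suc (a + b))) = s * t" by (simp add: s_def t_def power_add)
  let ?F = "qfact q (Suc (a + b))" and ?A = "qfact q a" and ?B = "qfact q b"
  have "qbinom q (Suc a) (Suc b) = (s * t - 1) * ?F / ((s - 1) * ?A * ((t - 1) * ?B))"
    unfolding qbinom_def by (simp add: pow[simplified] s_def t_def)
  moreover have "qbinom q a (Suc b) = ?F / (?A * ((t - 1) * ?B))"
    by (simp add: qbinom_def t_def)
  moreover have "qbinom q (Suc a) b = ?F / ((s - 1) * ?A * ?B)"
    by (simp add: qbinom_def s_def)
  moreover have "(s * t - 1) * F / ((s - 1) * A * ((t - 1) * B)) =
      F / (A * ((t - 1) * B)) + s * (F / ((s - 1) * A * B))"
    if "A \<noteq> 0" "B \<noteq> 0" for F A B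
    using st that by (simp add: divide_simps) (simp add: algebra_simps)
  ultimately show ?thesis
    using qfact_nonzero[OF assms] by (simp add: s_def del: power_Suc qfact.simps)
qed

lemma qbinom_Suc':
  assumes "q > 1"
  shows "qbinom q (Suc a) (Suc b) = q ^ Suc b * qbinom q a (Suc b) + qbinom q (Suc a) b"
  using qbinom_Suc[OF assms, of b a] qbinom_commute[of q] by simp

text \<open>Both sides are the q-multinomial coefficient with parts \<open>a\<close>,
  \<open>b\<close>, \<open>c\<close>.\<close>

lemma qbinom_assoc:
  assumes "q > 1"
  shows "qbinom q a (b + c) * qbinom q b c = qbinom q b (a + c) * qbinom q a c"
  using qfact_nonzero[OF assms] by (simp add: qbinom_def ac_simps)

section \<open>Inserting copies of one letter into a word\<close>

text \<open>For \<open>x\<close> not in \<open>v\<close> these are the shuffles of \<open>v\<close>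
  with \<open>r\<close> copies of \<open>x\<close>. As fibres of the deletion of \<open>x\<close>,
  the sets for distinct \<open>v\<close> are disjoint.\<close>

definition insertions :: "nat \<Rightarrow> nat \<Rightarrow> nat list \<Rightarrow> nat list set" where
  "insertions x r v = {u. filter (\<lambda>a. a \<noteq> x) u = v \<and> count_list u x = r}"

lemma count_list_filter_other: "P a \<Longrightarrow> count_list (filter P u) a = count_list u a"
  by (induction u) auto

lemma length_insertion:
  assumes "u \<in> insertions x r v"
  shows "length u = length v + r"
proof -
  have "count_list u x = length (filter (\<lambda>a. \<not> a \<noteq> x) u)"
    by (induction u) auto
  then show ?thesis
    using assms sum_length_filter_compl[of "\<lambda>a. a \<noteq> x" u] by (simp add: insertions_def)
qed

lemma finite_insertions [simp]: "finite (insertions x r v)"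
proof (rule finite_subset)
  have "set u \<subseteq> insert x (set v)" if "u \<in> insertions x r v" for u
    using that by (auto simp: insertions_def)
  then show "insertions x r v \<subseteq> {u. set u \<subseteq> insert x (set v) \<and> length u = length v + r}"
    using length_insertion by blast
qed (simp add: finite_lists_length_eq)

lemma insertions_Nil: "insertions x r [] = {replicate r x}"
proof (rule set_eqI)
  fix u
  have "u = replicate (count_list u x) x" if "\<forall>a\<in>set u. a = x"
    using that by (induction u) auto
  moreover have "count_list (replicate r x) x = r" by (induction r) auto
  ultimately show "u \<in> insertions x r [] \<longleftrightarrow> u \<in> {replicate r x}"
    by (auto simp: insertions_def filter_empty_conv)
qed

lemma insertions_0:
  assumes "x \<notin> set v"
  shows "insertions x 0 v = {v}"
proof -
  have "filter (\<lambda>a. a \<noteq> x) u = u" if "x \<notin> set u" for u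
    using that by (intro filter_True) auto
  then show ?thesis using assms by (auto simp: insertions_def count_list_0_iff)
qed

lemma insertions_Suc:
  assumes "y \<noteq> x"
  shows "insertions x (Suc r) (v @ [y]) =
    (\<lambda>u. u @ [x]) ` insertions x r (v @ [y]) \<union> (\<lambda>u. u @ [y]) ` insertions x (Suc r) v"
    (is "?L = ?R")
proof (intro set_eqI iffI)
  fix w assume w: "w \<in> ?L"
  then obtain u z where "w = u @ [z]" by (cases w rule: rev_cases) (auto simp: insertions_def)
  then show "w \<in> ?R" using w assms by (cases "z = x") (auto simp: insertions_def)
qed (use assms in \<open>auto simp: insertions_def\<close>)

lemma sum_insertions_Suc:
  fixes f :: "nat list \<Rightarrow> real"
  assumes "y \<noteq> x"
  shows "(\<Sum>u\<in>insertions x (Suc r) (v @ [y]). f u) =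
    (\<Sum>u\<in>insertions x r (v @ [y]). f (u @ [x])) + (\<Sum>u\<in>insertions x (Suc r) v. f (u @ [y]))"
  unfolding insertions_Suc[OF assms]
  using assms by (subst sum.union_disjoint) (auto simp: sum.reindex inj_on_def)

lemma length_filter_insertion:
  assumes "u \<in> insertions x r v" 
  shows "length (filter P u) = length (filter P v) + (if P x then r else 0)"
proof -
  have "length (filter P u) = length (filter P (filter (\<lambda>a. a \<noteq> x) u)) + (if P x then count_list u x else 0)"
    by (induction u) auto
  then show ?thesis using assms by (auto simp only: insertions_def mem_Collect_eq)
qed

lemma INV_replicate: "INV (replicate r x) = 0"
  by (induction r) (auto simp: INV_snoc simp flip: replicate_append_same)

text \<open>Split by the last letter. A final \<open>x\<close> makes no inversion, while a final
  \<open>y\<close> makes one with each of the \<open>Suc r\<close> copies of \<open>x\<close>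
  besides those within \<open>v\<close>; this is the first q-Pascal rule.\<close>

lemma sum_INV_insertions_max:
  assumes "q > 1" "\<forall>a\<in>set v. a < x"
  shows "(\<Sum>u\<in>insertions x r v. q ^ INV u) = q ^ INV v * qbinom q r (length v)"
  using assms(2)
proof (induction v arbitrary: r rule: rev_induct)
  case Nil
  then show ?case using assms(1) by (simp add: insertions_Nil INV_replicate)
next
  case (snoc y v)
  then have y: "y < x" "y \<noteq> x" by auto
  show ?case
  proof (induction r)
    case 0
    have "x \<notin> set (v @ [y])" using snoc.prems by auto
    then show ?case using assms(1) insertions_0 by simp
  next
    case (Suc r)
    have F: "filter (\<lambda>a. a > x) (v @ [y]) = []"
      using snoc.prems by (auto simp: filter_empty_conv)
    have 1: "q ^ INV (u @ [x]) = q ^ INV u" if "u \<in> insertions x r (v @ [y])" for u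
      using length_filter_insertion[OF that, of "\<lambda>a. a > x"] unfolding F
      by (simp add: INV_snoc)
    have 2: "q ^ INV (u @ [y]) = q ^ (length (filter (\<lambda>a. a > y) v) + Suc r) * q ^ INV u"
      if "u \<in> insertions x (Suc r) v" for u
      using length_filter_insertion[OF that, of "\<lambda>a. a > y"] y(1)
      by (simp add: INV_snoc power_add)
    have "(\<Sum>u\<in>insertions x (Suc r) (v @ [y]). q ^ INV u) =
      (\<Sum>u\<in>insertions x r (v @ [y]). q ^ INV u) +
        q ^ (length (filter (\<lambda>a. a > y) v) + Suc r) * (\<Sum>u\<in>insertions x (Suc r) v. q ^ INV u)"
      unfolding sum_insertions_Suc[OF y(2)] sum_distrib_left
      by (intro arg_cong2[where f = plus] sum.cong 1 2 refl)
    also have "\<dots> = q ^ INV (v @ [y]) * qbinom q r (Suc (length v)) +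
       q ^ (length (filter (\<lambda>a. a > y) v) + Suc r) * (q ^ INV v * qbinom q (Suc r) (length v))"
      using Suc snoc by simp
    also have "\<dots> = q ^ INV (v @ [y]) * (qbinom q r (Suc (length v)) + q ^ Suc r * qbinom q (Suc r) (length v))"
      by (simp add: INV_snoc power_add algebra_simps)
    finally show ?case using qbinom_Suc[OF assms(1), of r "length v"] by simp
  qed
qed

text \<open>Here a final \<open>x\<close> makes an inversion with every letter of
  \<open>v @ [y]\<close>, and a final \<open>y\<close> makes none with the copies of
  \<open>x\<close>; this is the second q-Pascal rule.\<close>

lemma sum_INV_insertions_min:
  assumes "q > 1" "\<forall>a\<in>set v. a > x"
  shows "(\<Sum>u\<in>insertions x r v. q ^ INV u) = q ^ INV v * qbinom q r (length v)"
  using assms(2)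
proof (induction v arbitrary: r rule: rev_induct)
  case Nil
  then show ?case using assms(1) by (simp add: insertions_Nil INV_replicate)
next
  case (snoc y v)
  then have y: "y > x" "y \<noteq> x" by auto
  show ?case
  proof (induction r)
    case 0
    have "x \<notin> set (v @ [y])" using snoc.prems by auto
    then show ?case using assms(1) insertions_0 by simp
  next
    case (Suc r)
    have F: "filter (\<lambda>a. a > x) (v @ [y]) = v @ [y]"
      using snoc.prems by (intro filter_True)
    have 1: "q ^ INV (u @ [x]) = q ^ Suc (length v) * q ^ INV u" if "u \<in> insertions x r (v @ [y])" for u
      using length_filter_insertion[OF that, of "\<lambda>a. a > x"] unfolding F
      by (simp add: INV_snoc power_add)
    have 2: "q ^ INV (u @ [y]) = q ^ length (filter (\<lambda>a. a > y) v) * q ^ INV u"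
      if "u \<in> insertions x (Suc r) v" for u
      using length_filter_insertion[OF that, of "\<lambda>a. a > y"] y(1)
      by (simp add: INV_snoc power_add)
    have "(\<Sum>u\<in>insertions x (Suc r) (v @ [y]). q ^ INV u) =
      q ^ Suc (length v) * (\<Sum>u\<in>insertions x r (v @ [y]). q ^ INV u) +
        q ^ length (filter (\<lambda>a. a > y) v) * (\<Sum>u\<in>insertions x (Suc r) v. q ^ INV u)"
      unfolding sum_insertions_Suc[OF y(2)] sum_distrib_left
      by (intro arg_cong2[where f = plus] sum.cong 1 2 refl)
    also have "\<dots> = q ^ Suc (length v) * (q ^ INV (v @ [y]) * qbinom q r (Suc (length v))) +
       q ^ length (filter (\<lambda>a. a > y) v) * (q ^ INV v * qbinom q (Suc r) (length v))"
      using Suc snoc by simp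
    also have "\<dots> = q ^ INV (v @ [y]) * (q ^ Suc (length v) * qbinom q r (Suc (length v)) + qbinom q (Suc r) (length v))"
      by (simp add: INV_snoc power_add algebra_simps)
    finally show ?case using qbinom_Suc'[OF assms(1), of r "length v"] by simp
  qed
qed

text \<open>Tails are listed from right to left here: the head of \<open>R\<close> is the last letter of the words.\<close>

definition tail_words :: "nat list \<Rightarrow> (nat \<Rightarrow> nat) \<Rightarrow> nat list set" where
  "tail_words R k = {w. remdups w = rev R \<and> (\<forall>a\<in>set R. count_list w a = k a)}"

lemma set_tail_word: "w \<in> tail_words R k \<Longrightarrow> set w = set R"
  unfolding tail_words_def using set_remdups[of w] by auto

lemma length_tail_word:
  assumes "w \<in> tail_words R k"
  shows "length w = sum_list (map k R)"
proof -
  have "distinct R" using assms distinct_remdups[of w] by (simp add: tail_words_def)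
  have "length w = sum (count_list w) (set R)"
    using sum_count_set[of w "set R"] set_tail_word[OF assms] by simp
  also have "\<dots> = sum k (set R)"
    using assms by (intro sum.cong) (auto simp: tail_words_def)
  finally show ?thesis using \<open>distinct R\<close> by (simp add: sum.distinct_set_conv_list)
qed

lemma finite_tail_words [simp]: "finite (tail_words R k)"
  by (rule finite_subset[of _ "{w. set w \<subseteq> set R \<and> length w = sum_list (map k R)}"])
    (auto simp: length_tail_word set_tail_word finite_lists_length_eq)

lemma tail_words_Nil: "tail_words [] k = {[]}"
  by (auto simp: tail_words_def)

text \<open>For a consecutive tail, the power of \<open>q\<close> accounts for the inversions of the
  final \<open>x\<close> and the q-binomial for those between its other copies and the remaining
  letters. For \<open>Z\<close> the same product holds for every tail.\<close>

primrec tail_gf :: "real \<Rightarrow> (nat \<Rightarrow> nat) \<Rightarrow> nat list \<Rightarrow> real" where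
  "tail_gf q k [] = 1"
| "tail_gf q k (x # R) = q ^ sum_list (map k (filter (\<lambda>a. a > x) R))
      * qbinom q (k x - 1) (sum_list (map k R)) * tail_gf q k R"

text \<open>One copy of \<open>x\<close> must come last; the other \<open>k x - 1\<close> copies are
  free, since they do not affect the tail.\<close>

lemma tail_words_Cons_insertions:
  assumes "x \<notin> set R" "k x \<ge> 1"
  shows "tail_words (x # R) k = (\<Union>v\<in>tail_words R k. (\<lambda>u. u @ [x]) ` insertions x (k x - 1) v)"
    (is "?L = ?R")
proof (intro set_eqI iffI)
  fix w assume w: "w \<in> ?L"
  then have "w \<noteq> []" by (auto simp: tail_words_def)
  then obtain u y where u: "w = u @ [y]" by (cases w rule: rev_cases) auto
  have "last w = x" using w last_remdups[OF \<open>w \<noteq> []\<close>] by (simp add: tail_words_def)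
  then have y: "y = x" using u by simp
  let ?v = "filter (\<lambda>a. a \<noteq> x) u"
  have "count_list ?v a = k a" if "a \<in> set R" for a
  proof -
    have "a \<noteq> x" using that assms by auto
    then show ?thesis
      using that w unfolding u y by (auto simp: tail_words_def count_list_filter_other)
  qed
  then have "?v \<in> tail_words R k"
    using w assms unfolding u y by (auto simp: tail_words_def remdups_snoc remdups_filter)
  moreover have "u \<in> insertions x (k x - 1) ?v"
    using w unfolding u y by (auto simp: tail_words_def insertions_def)
  ultimately show "w \<in> ?R" using u y by blast
next
  fix w assume "w \<in> ?R"
  then obtain v u where v: "v \<in> tail_words R k" "u \<in> insertions x (k x - 1) v" "w = u @ [x]" by blast
  have "remdups v = filter (\<lambda>a. a \<noteq> x) (remdups u)"
    using v by (auto simp: insertions_def remdups_filter)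
  moreover have "count_list v a = count_list u a" if "a \<in> set R" for a
  proof -
    have "a \<noteq> x" using that assms by auto
    then show ?thesis using v by (auto simp: insertions_def count_list_filter_other)
  qed
  ultimately show "w \<in> ?L"
    using v assms by (auto simp: tail_words_def remdups_snoc insertions_def)
qed

lemma sum_INV_tail_words:
  assumes "q > 1" "consecutive (rev R)" "distinct R" "\<forall>a\<in>set R. k a \<ge> 1"
  shows "(\<Sum>w\<in>tail_words R k. q ^ INV w) = tail_gf q k R"
  using assms(2-)
proof (induction R)
  case Nil
  then show ?case by (simp add: tail_words_Nil)
next
  case (Cons x R)
  obtain a b where ab: "set R = {a..b}"
    using consecutive_interval[of "rev R"] Cons.prems(1) by (auto simp: consecutive_snoc)
  \<comment> \<open>The earlier letters form an interval missing \<open>x\<close>, so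
    \<open>x\<close> is smaller or larger than all of them and one of the two insertion formulas
    applies.\<close>
  have ext: "(\<forall>y\<in>set R. y < x) \<or> (\<forall>y\<in>set R. y > x)"
    using ab Cons.prems(2) by auto
  have step: "(\<Sum>u\<in>insertions x (k x - 1) v. q ^ INV (u @ [x])) =
      q ^ sum_list (map k (filter (\<lambda>a. a > x) R)) * qbinom q (k x - 1) (sum_list (map k R)) * q ^ INV v"
    if v: "v \<in> tail_words R k" for v
  proof -
    have e: "INV (u @ [x]) = INV u + sum_list (map k (filter (\<lambda>a. a > x) R))"
      if u: "u \<in> insertions x (k x - 1) v" for u
    proof -
      have "length (filter (\<lambda>a. a > x) v) = sum_list (map k (filter (\<lambda>a. a > x) R))"
      proof (cases "\<forall>y\<in>set R. y < x")
        case True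
        then have "filter (\<lambda>a. a > x) v = []" "filter (\<lambda>a. a > x) R = []"
          using set_tail_word[OF v] by (auto simp: filter_empty_conv)
        then show ?thesis by simp
      next
        case False
        then have "filter (\<lambda>a. a > x) v = v" "filter (\<lambda>a. a > x) R = R"
          using ext set_tail_word[OF v] by (auto intro!: filter_True)
        then show ?thesis using length_tail_word[OF v] by simp
      qed
      then show ?thesis
        using length_filter_insertion[OF u, of "\<lambda>a. a > x"] by (simp add: INV_snoc)
    qed
    have "(\<Sum>u\<in>insertions x (k x - 1) v. q ^ INV (u @ [x])) =
       q ^ sum_list (map k (filter (\<lambda>a. a > x) R)) * (\<Sum>u\<in>insertions x (k x - 1) v. q ^ INV u)"
      unfolding sum_distrib_left by (intro sum.cong) (auto simp: e power_add)
    also have "(\<Sum>u\<in>insertions x (k x - 1) v. q ^ INV u) = q ^ INV v * qbinom q (k x - 1) (length v)"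
      using ext set_tail_word[OF v] sum_INV_insertions_max[OF assms(1)] sum_INV_insertions_min[OF assms(1)]
      by metis
    finally show ?thesis using length_tail_word[OF v] by simp
  qed
  have "(\<Sum>w\<in>tail_words (x # R) k. q ^ INV w) =
      (\<Sum>v\<in>tail_words R k. \<Sum>w\<in>(\<lambda>u. u @ [x]) ` insertions x (k x - 1) v. q ^ INV w)"
    using Cons.prems
    by (subst tail_words_Cons_insertions, simp, simp, intro sum.UNION_disjoint ballI impI)
      (simp_all, auto simp: insertions_def)
  also have "\<dots> = (\<Sum>v\<in>tail_words R k. \<Sum>u\<in>insertions x (k x - 1) v. q ^ INV (u @ [x]))"
    by (rule sum.cong[OF refl]) (simp add: sum.reindex inj_on_def)
  also have "\<dots> = tail_gf q k (x # R)"
    using Cons by (simp add: step[simplified] consecutive_snoc flip: sum_distrib_left)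
  finally show ?case .
qed

subsection \<open>The statistic \<open>Z\<close>\<close>

text \<open>Only subwords on a pair containing \<open>x\<close> grow. A descent at the end requires
  the other letter \<open>j\<close> to be larger and last in the old subword, and the descent
  position is then the length of that subword.\<close>

lemma Z_snoc:
  assumes "1 \<le> x"
  shows "Z m (v @ [x]) = Z m v + (\<Sum>j\<in>{x<..m}.
    let u = filter (\<lambda>y. y = x \<or> y = j) v in if u \<noteq> [] \<and> last u = j then length u else 0)"
    (is "_ = _ + sum ?g _")
proof -
  let ?A = "{(i, j). 1 \<le> i \<and> i < j \<and> j \<le> m}"
  let ?f = "\<lambda>w (i, j). MAJ (filter (\<lambda>y. y = i \<or> y = j) w)"
  have fin: "finite ?A" by (rule finite_subset[of _ "{..m} \<times> {..m}"]) auto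
  have "?f (v @ [x]) p = ?f v p + (if fst p = x then ?g (snd p) else 0)" if pA: "p \<in> ?A" for p
  proof -
    obtain i j where p: "p = (i, j)" "i < j" using pA by auto
    let ?u = "filter (\<lambda>y. y = i \<or> y = j) v"
    have lu: "last ?u = i \<or> last ?u = j" if "?u \<noteq> []"
      using last_in_set[OF that] by auto
    consider "i = x" | "j = x" | "i \<noteq> x" "j \<noteq> x" by blast
    then show ?thesis
    proof cases
      case 1
      then show ?thesis using p lu by (auto simp: MAJ_snoc Let_def)
    next
      case 2
      then show ?thesis using p lu by (auto simp: MAJ_snoc)
    next
      case 3
      then show ?thesis using p by auto
    qed
  qed
  then have "Z m (v @ [x]) = (\<Sum>p\<in>?A. ?f v p + (if fst p = x then ?g (snd p) else 0))"
    unfolding Z_def by (intro sum.cong refl)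
  also have "\<dots> = Z m v + (\<Sum>p\<in>?A. if fst p = x then ?g (snd p) else 0)"
    by (simp only: sum.distrib Z_def)
  also have "(\<Sum>p\<in>?A. if fst p = x then ?g (snd p) else 0) = (\<Sum>p\<in>{p \<in> ?A. fst p = x}. ?g (snd p))"
    using fin by (rule sum.inter_filter[symmetric])
  also have "\<dots> = sum ?g {x<..m}"
    by (rule sum.reindex_bij_witness[of _ "\<lambda>j. (x, j)" snd]) (use assms in auto)
  finally show ?thesis .
qed

lemma count_list_pair: "x \<noteq> j \<Longrightarrow> length (filter (\<lambda>y. y = x \<or> y = j) v) = count_list v x + count_list v j"
  by (induction v) auto

text \<open>\<open>B\<close> is the part of the tail behind the last \<open>x\<close> of
  \<open>v\<close>; \<open>A = []\<close> means that \<open>x\<close> does not occur in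
  \<open>v\<close>. For \<open>j > x\<close>, the old subword on \<open>x\<close> and
  \<open>j\<close> ends in \<open>j\<close> exactly when \<open>j\<close> is in
  \<open>B\<close>.\<close>

lemma Z_snoc_remdups:
  assumes "1 \<le> x" "remdups v = A @ B" "x \<notin> set B" "A = [] \<or> last A = x" "set B \<subseteq> {1..m}"
  shows "Z m (v @ [x]) = Z m v + sum_list (map (\<lambda>j. count_list v x + count_list v j) (filter (\<lambda>j. j > x) B))"
proof -
  have "distinct (A @ B)" using distinct_remdups[of v] assms(2) by simp
  let ?u = "\<lambda>j. filter (\<lambda>y. y = x \<or> y = j) v"
  have u: "?u j \<noteq> [] \<and> last (?u j) = j \<longleftrightarrow> j \<in> set B" if "j > x" for j
  proof -
    let ?F = "filter (\<lambda>y. y = x \<or> y = j)"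
    have "?u j \<noteq> [] \<and> last (?u j) = j \<longleftrightarrow> remdups (?u j) \<noteq> [] \<and> last (remdups (?u j)) = j"
      using last_remdups[of "?u j"] by auto
    moreover have "remdups (?u j) = ?F A @ ?F B"
      using assms(2) by (simp add: remdups_filter)
    moreover have "?F B = (if j \<in> set B then [j] else [])"
    proof (cases "j \<in> set B")
      case True
      have "?F B = filter (\<lambda>y. y = j) B" using assms(3) by (intro filter_cong) auto
      also have "\<dots> = [j]" using True \<open>distinct (A @ B)\<close>
        by (induction B) (auto simp: filter_empty_conv)
      finally show ?thesis using True by simp
    next
      case False
      then show ?thesis using assms(3) by (auto simp: filter_empty_conv)
    qed
    moreover have "?F A = [] \<or> last (?F A) = x"
      using assms(4) by (cases A rule: rev_cases) auto
    ultimately show ?thesis using that by auto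
  qed
  have "Z m (v @ [x]) = Z m v + (\<Sum>j\<in>{x<..m}. if j \<in> set B then count_list v x + count_list v j else 0)"
    unfolding Z_snoc[OF assms(1)] Let_def
    by (intro arg_cong2[where f = plus] sum.cong refl)
      (simp add: u count_list_pair split del: if_split cong: if_cong)
  also have "(\<Sum>j\<in>{x<..m}. if j \<in> set B then count_list v x + count_list v j else 0) =
     sum (\<lambda>j. count_list v x + count_list v j) (set (filter (\<lambda>j. j > x) B))"
    by (subst sum.inter_filter[symmetric]) (use assms(5) in \<open>auto intro!: sum.cong\<close>)
  also have "\<dots> = sum_list (map (\<lambda>j. count_list v x + count_list v j) (filter (\<lambda>j. j > x) B))"
    using \<open>distinct (A @ B)\<close> by (subst sum.distinct_set_conv_list) auto
  finally show ?thesis .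
qed

text \<open>
  The summand \<open>p\<close> belongs to the words in whose tail, after deletion of the final \<open>x\<close>, exactly \<open>p\<close>
  letters follow \<open>x\<close>.
\<close>

lemma tail_gf_insert:
  assumes "q > 1" "x \<notin> set R" "k x \<ge> 2" "\<forall>a\<in>set R. k a \<ge> 1"
  shows "tail_gf q k (x # R) = (\<Sum>p\<le>length R.
    q ^ sum_list (map (\<lambda>j. k x - 1 + k j) (filter (\<lambda>j. j > x) (take p R)))
      * tail_gf q (k(x := k x - 1)) (take p R @ x # drop p R))"
    (is "_ = ?S R")
  using assms(2,4)
proof (induction R)
  case Nil
  then show ?case using assms(1) by simp
next
  case (Cons z R)
  let ?k = "k(x := k x - 1)"
  obtain A where A: "k x = A + 2" using assms(3) by (metis add.commute le_Suc_ex)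
  obtain B where B: "k z = B + 1" using Cons.prems(2) by (metis add.commute le_Suc_ex list.set_intros(1))
  define K where "K = sum_list (map k R)"
  define e where "e = sum_list (map k (filter (\<lambda>a. a > z) R))"
  define f where "f = sum_list (map k (filter (\<lambda>a. a > x) R))"
  define c where "c = (if z > x then B + 1 else 0)"
  define c' where "c' = (if x > z then A + 1 else 0)"
  have xz: "x \<noteq> z" "x \<notin> set R" using Cons.prems by auto
  have kk: "map ?k R = map k R" "map ?k (filter P R) = map k (filter P R)" for P
    using xz by (auto intro!: map_cong)
  have split: "sum_list (map g (filter P (take p R))) + sum_list (map g (filter P (drop p R))) =
      sum_list (map g (filter P R))" for g :: "nat \<Rightarrow> nat" and P p
    by (metis append_take_drop_id filter_append map_append sum_list_append)
  have xt: "x \<notin> set (take p R)" "x \<notin> set (drop p R)" for p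
    using xz by (auto dest: in_set_takeD in_set_dropD)
  have lhs: "tail_gf q k (x # z # R) = q ^ (f + c) * qbinom q (A + 1) (K + B + 1) *
      (q ^ e * qbinom q B K * tail_gf q k R)"
    by (simp add: A B K_def e_def f_def c_def add_ac)
  have tg: "tail_gf q (k(x := n)) R = tail_gf q k R" for n
    using xz(2) by (induction R) (auto intro!: arg_cong2[where f = times] arg_cong[where f = "power q"]
      arg_cong[where f = sum_list] arg_cong2[where f = "qbinom q"] map_cong)
  \<comment> \<open>The summand \<open>p = 0\<close>, in which the tail stays the same.\<close>
  have first: "tail_gf q ?k (x # z # R) = q ^ (f + c) * qbinom q A (K + B + 1) *
      (q ^ e * qbinom q B K * tail_gf q k R)"
    using xz by (simp add: A B K_def e_def f_def c_def kk tg add_ac)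
  \<comment> \<open>In the other summands \<open>z\<close> is the last letter of the new tail.
    Splitting off its contribution leaves a factor independent of \<open>p\<close> times a summand
    for \<open>R\<close>.\<close>
  have rest: "q ^ sum_list (map (\<lambda>j. k x - 1 + k j) (filter (\<lambda>j. j > x) (take (Suc p) (z # R))))
      * tail_gf q ?k (take (Suc p) (z # R) @ x # drop (Suc p) (z # R)) =
    q ^ (A + 1 + c + e) * qbinom q B (K + A + 1) *
     (q ^ sum_list (map (\<lambda>j. k x - 1 + k j) (filter (\<lambda>j. j > x) (take p R)))
      * tail_gf q ?k (take p R @ x # drop p R))" for p
  proof -
    let ?Q = "take p R @ x # drop p R"
    have "sum_list (map ?k (filter (\<lambda>a. a > z) ?Q)) = e + c'"
      using split[of k "\<lambda>a. a > z" p] A by (simp add: xt e_def c'_def)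
    moreover have "sum_list (map ?k ?Q) = K + A + 1"
      using split[of k "\<lambda>_. True" p] A by (simp add: xt K_def)
    ultimately have Q: "tail_gf q ?k (z # ?Q) = q ^ (e + c') * qbinom q B (K + A + 1) * tail_gf q ?k ?Q"
      using xz B by simp
    have z: "sum_list (map (\<lambda>j. k x - 1 + k j) (filter (\<lambda>j. j > x) (take (Suc p) (z # R)))) =
       (if z > x then A + 1 + (B + 1) else 0) + sum_list (map (\<lambda>j. k x - 1 + k j) (filter (\<lambda>j. j > x) (take p R)))"
      by (simp add: A B)
    \<comment> \<open>The exponent does not depend on the order of \<open>x\<close> and
      \<open>z\<close>: the \<open>A + 1\<close> remaining copies of \<open>x\<close> enter through
      the deletion weight if \<open>z > x\<close>, and through the factor of \<open>z\<close> in
      \<open>tail_gf\<close> if \<open>x > z\<close>.\<close>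
    have ex: "A + 1 + c + e = (if z > x then A + 1 + (B + 1) else 0) + (e + c')"
      using xz(1) by (auto simp: c_def c'_def)
    have T: "take (Suc p) (z # R) @ x # drop (Suc p) (z # R) = z # ?Q" by simp
    show ?thesis unfolding z T Q ex by (simp only: power_add mult_ac)
  qed
  have "?S (z # R) = tail_gf q ?k (x # z # R) + q ^ (A + 1 + c + e) * qbinom q B (K + A + 1) * ?S R"
    unfolding list.size add_Suc_right add_0_right sum.atMost_Suc_shift rest sum_distrib_left by simp
  also have "?S R = tail_gf q k (x # R)"
    using Cons by simp
  also have "\<dots> = q ^ f * qbinom q (A + 1) K * tail_gf q k R"
    by (simp add: A f_def K_def)
  finally have "?S (z # R) = q ^ (f + c + e) * tail_gf q k R *
     (qbinom q A (K + B + 1) * qbinom q B K + q ^ (A + 1) * (qbinom q B (K + A + 1) * qbinom q (A + 1) K))"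
    unfolding first by (simp add: power_add algebra_simps)
  \<comment> \<open>Regrouping the q-multinomial exposes the common factor
    \<open>qbinom q B K\<close>; the q-Pascal rule then merges the two terms.\<close>
  also have "qbinom q B (K + A + 1) * qbinom q (A + 1) K = qbinom q (A + 1) (K + B) * qbinom q B K"
    using qbinom_assoc[OF assms(1), of B "A + 1" K] by (simp add: ac_simps)
  also have "qbinom q A (K + B + 1) * qbinom q B K + q ^ (A + 1) * (qbinom q (A + 1) (K + B) * qbinom q B K) =
     qbinom q (A + 1) (K + B + 1) * qbinom q B K"
    using qbinom_Suc[OF assms(1), of A "K + B"] by (simp add: algebra_simps)
  finally show ?case unfolding lhs by (simp add: power_add mult_ac)
qed

lemma tail_words_Cons_1:
  assumes "x \<notin> set R" "k x = 1"
  shows "tail_words (x # R) k = (\<lambda>v. v @ [x]) ` tail_words R k"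
proof -
  have "insertions x 0 v = {v}" if "v \<in> tail_words R k" for v
    using insertions_0 set_tail_word[OF that] assms(1) by simp
  then show ?thesis using assms by (auto simp: tail_words_Cons_insertions)
qed

text \<open>Without the final \<open>x\<close>, the preceding copy of \<open>x\<close> becomes its
  last occurrence. It may sit anywhere among the otherwise unchanged tail letters, with the
  \<open>p\<close> letters of \<open>take p R\<close> to its right.\<close>

lemma tail_words_Cons_ge_2:
  assumes "x \<notin> set R" "distinct R" "k x \<ge> 2"
  shows "tail_words (x # R) k = (\<lambda>v. v @ [x]) `
    (\<Union>p\<le>length R. tail_words (take p R @ x # drop p R) (k(x := k x - 1)))" (is "?L = ?R")
proof (intro set_eqI iffI)
  let ?k = "k(x := k x - 1)"
  fix w assume w: "w \<in> ?L"
  then have "w \<noteq> []" by (auto simp: tail_words_def)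
  then obtain v y where v: "w = v @ [y]" by (cases w rule: rev_cases) auto
  have "last w = x" using w last_remdups[OF \<open>w \<noteq> []\<close>] by (simp add: tail_words_def)
  then have y: "y = x" using v by simp
  have f: "filter (\<lambda>a. a \<noteq> x) (remdups v) = rev R" and cx: "count_list v x = k x - 1"
    and ca: "\<forall>a\<in>set R. count_list v a = k a"
    using w assms(1) unfolding v y by (auto simp: tail_words_def remdups_snoc split: if_splits)
  have "count_list v x \<noteq> 0" using cx assms(3) by simp
  then have "x \<in> set (remdups v)" by (simp add: count_list_0_iff)
  then obtain A B where AB: "remdups v = A @ x # B" by (meson split_list)
  then have "x \<notin> set A" "x \<notin> set B" using distinct_remdups[of v] by auto
  then have "filter (\<lambda>a. a \<noteq> x) (remdups v) = A @ B"
    unfolding AB by (auto intro!: arg_cong2[where f = append] filter_True)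
  then have R: "R = rev B @ rev A" using f by (metis rev_append rev_swap)
  have "v \<in> tail_words (take (length B) R @ x # drop (length B) R) ?k"
    using cx ca assms(1) by (auto simp: tail_words_def AB R)
  moreover have "length B \<le> length R" by (simp add: R)
  ultimately show "w \<in> ?R" unfolding v y by blast
next
  fix w assume "w \<in> ?R"
  then obtain p v where v: "w = v @ [x]" "v \<in> tail_words (take p R @ x # drop p R) (k(x := k x - 1))" by blast
  have "filter (\<lambda>a. a \<noteq> x) (remdups v) = rev (take p R @ drop p R)"
  proof -
    have "filter (\<lambda>a. a \<noteq> x) (rev (drop p R)) = rev (drop p R)"
      "filter (\<lambda>a. a \<noteq> x) (rev (take p R)) = rev (take p R)"
      using assms(1) by (auto intro!: filter_True dest: in_set_takeD in_set_dropD)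
    then show ?thesis using v(2) by (simp add: tail_words_def del: append_take_drop_id)
  qed
  moreover have "count_list v a = (k(x := k x - 1)) a" if "a \<in> insert x (set R)" for a
  proof -
    have "set (take p R @ x # drop p R) = insert x (set R)"
      by (metis append_take_drop_id insert_is_Un list.simps(15) set_append sup_left_commute)
    then show ?thesis using v(2) that unfolding tail_words_def by blast
  qed
  ultimately show "w \<in> ?L" using v(1) assms by (auto simp: tail_words_def remdups_snoc)
qed

text \<open>Induction on the word length, with tail and multiplicities arbitrary: deleting the final
  letter changes both, and the new tail need not be consecutive even if the old one was.\<close>

lemma sum_Z_tail_words:
  assumes "q > 1" "distinct R" "\<forall>a\<in>set R. k a \<ge> 1" "set R \<subseteq> {1..m}"
  shows "(\<Sum>w\<in>tail_words R k. q ^ Z m w) = tail_gf q k R"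
  using assms(2-)
proof (induction "sum_list (map k R)" arbitrary: R k rule: less_induct)
  case less
  show ?case
  proof (cases R)
    case Nil
    then show ?thesis by (simp add: tail_words_Nil Z_def case_prod_unfold)
  next
    case (Cons x S)
    then have x: "x \<notin> set S" "distinct S" "k x \<ge> 1" "1 \<le> x" and S: "set S \<subseteq> {1..m}" "\<forall>a\<in>set S. k a \<ge> 1"
      using less.prems by auto
    show ?thesis
    proof (cases "k x = 1")
      case True
      have Zv: "Z m (v @ [x]) = Z m v + sum_list (map k (filter (\<lambda>j. j > x) S))"
        if v: "v \<in> tail_words S k" for v
      proof -
        have "count_list v x = 0" using set_tail_word[OF v] x by (simp add: count_list_0_iff)
        moreover have "sum_list (map (count_list v) (filter (\<lambda>j. j > x) S)) = sum_list (map k (filter (\<lambda>j. j > x) S))"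
          using v by (intro arg_cong[where f = sum_list] map_cong) (auto simp: tail_words_def)
        moreover have "Z m (v @ [x]) = Z m v + sum_list (map (\<lambda>j. count_list v x + count_list v j) (filter (\<lambda>j. j > x) (rev S)))"
          by (rule Z_snoc_remdups[where A = "[]"]) (use v x S in \<open>auto simp: tail_words_def\<close>)
        ultimately show ?thesis by (simp flip: rev_filter rev_map)
      qed
      have "(\<Sum>w\<in>tail_words R k. q ^ Z m w) = (\<Sum>v\<in>tail_words S k. q ^ Z m (v @ [x]))"
        unfolding Cons tail_words_Cons_1[of x S k, OF x(1) True] by (simp add: sum.reindex inj_on_def)
      also have "\<dots> = q ^ sum_list (map k (filter (\<lambda>j. j > x) S)) * (\<Sum>v\<in>tail_words S k. q ^ Z m v)"
        unfolding sum_distrib_left by (intro sum.cong) (auto simp: Zv power_add)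
      also have "(\<Sum>v\<in>tail_words S k. q ^ Z m v) = tail_gf q k S"
        using less.hyps[of k S] x S Cons by simp
      finally show ?thesis using True Cons assms(1) by simp
    next
      case False
      then have k2: "k x \<ge> 2" using x by simp
      let ?k = "k(x := k x - 1)"
      let ?T = "\<lambda>p. take p S @ x # drop p S"
      have setT: "set (?T p) = insert x (set S)" for p
        by (metis append_take_drop_id insert_is_Un list.simps(15) set_append sup_left_commute)
      have distT: "distinct (?T p)" for p
        using x by (auto dest: in_set_takeD in_set_dropD simp: set_take_disj_set_drop_if_distinct)
      \<comment> \<open>The letters before \<open>x\<close> in \<open>?T p\<close> recover
        \<open>p\<close>, so different \<open>p\<close> give different tails and disjoint sets of
        words.\<close>
      have inj: "p = p'" if "?T p = ?T p'" "p \<le> length S" "p' \<le> length S" for p p'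
      proof -
        have "takeWhile (\<lambda>a. a \<noteq> x) (?T p) = take p S" for p
          using x(1) by (subst takeWhile_append2) (auto dest: in_set_takeD)
        then have "take p S = take p' S" using that(1) by metis
        then show ?thesis using that by (metis length_take min.absorb2)
      qed
      have sumT: "sum_list (map ?k (?T p)) < sum_list (map k R)" for p
      proof -
        have "x \<notin> set (take p S)" "x \<notin> set (drop p S)"
          using x(1) by (auto dest: in_set_takeD in_set_dropD)
        then have "sum_list (map ?k (?T p)) = sum_list (map k (take p S)) + sum_list (map k (drop p S)) + (k x - 1)"
          by simp
        also have "sum_list (map k (take p S)) + sum_list (map k (drop p S)) = sum_list (map k S)"
          by (metis append_take_drop_id map_append sum_list_append)
        finally have "sum_list (map ?k (?T p)) = sum_list (map k S) + (k x - 1)" .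
        moreover have "sum_list (map k R) = k x + sum_list (map k S)" using Cons by simp
        ultimately show ?thesis using x(3) by linarith
      qed
      have IH: "(\<Sum>w\<in>tail_words (?T p) ?k. q ^ Z m w) = tail_gf q ?k (?T p)" for p
        using less.hyps[OF sumT distT] k2 S x less.prems Cons unfolding setT by simp
      have Zv: "Z m (v @ [x]) = Z m v + sum_list (map (\<lambda>j. k x - 1 + k j) (filter (\<lambda>j. j > x) (take p S)))"
        if v: "v \<in> tail_words (?T p) ?k" for v p
      proof -
        have c: "count_list v a = ?k a" if "a \<in> insert x (set S)" for a
          using v that setT unfolding tail_words_def by blast
        \<comment> \<open>Read from left to right, the tail of \<open>v\<close> is
          \<open>rev (?T p)\<close>; it is cut just after \<open>x\<close>.\<close>
        have "Z m (v @ [x]) = Z m v + sum_list (map (\<lambda>j. count_list v x + count_list v j) (filter (\<lambda>j. j > x) (rev (take p S))))"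
          by (rule Z_snoc_remdups[where A = "rev (drop p S) @ [x]"])
            (use v x S in \<open>auto simp: tail_words_def dest: in_set_takeD\<close>)
        moreover have "sum_list (map (\<lambda>j. count_list v x + count_list v j) (filter (\<lambda>j. j > x) (take p S))) =
            sum_list (map (\<lambda>j. k x - 1 + k j) (filter (\<lambda>j. j > x) (take p S)))"
          using x(1) by (intro arg_cong[where f = sum_list] map_cong) (auto simp: c dest: in_set_takeD)
        ultimately show ?thesis by (simp flip: rev_filter rev_map)
      qed
      have "(\<Sum>w\<in>tail_words R k. q ^ Z m w) = (\<Sum>v\<in>(\<Union>p\<le>length S. tail_words (?T p) ?k). q ^ Z m (v @ [x]))"
        unfolding Cons tail_words_Cons_ge_2[of x S k, OF x(1,2) k2] by (subst sum.reindex) (auto simp: inj_on_def)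
      also have "\<dots> = (\<Sum>p\<le>length S. \<Sum>v\<in>tail_words (?T p) ?k. q ^ Z m (v @ [x]))"
      proof (rule sum.UNION_disjoint)
        show "\<forall>i\<in>{..length S}. \<forall>j\<in>{..length S}. i \<noteq> j \<longrightarrow> tail_words (?T i) ?k \<inter> tail_words (?T j) ?k = {}"
        proof (intro ballI impI, rule ccontr)
          fix i j assume ij: "i \<in> {..length S}" "j \<in> {..length S}" "i \<noteq> j"
            "tail_words (?T i) ?k \<inter> tail_words (?T j) ?k \<noteq> {}"
          then obtain w where "remdups w = rev (?T i)" "remdups w = rev (?T j)"
            unfolding tail_words_def by blast
          then have "?T i = ?T j" by (metis rev_rev_ident)
          then have "i = j" using inj[of i j] ij(1,2) unfolding atMost_iff by blast
          then show False using ij(3) by contradiction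
        qed
      qed auto
      also have "\<dots> = (\<Sum>p\<le>length S. q ^ sum_list (map (\<lambda>j. k x - 1 + k j) (filter (\<lambda>j. j > x) (take p S)))
          * tail_gf q ?k (?T p))"
        unfolding IH[symmetric] sum_distrib_left by (intro sum.cong refl) (simp add: Zv power_add)
      also have "\<dots> = tail_gf q k R"
        unfolding Cons using tail_gf_insert[OF assms(1) x(1) k2 S(2)] by simp
      finally show ?thesis .
    qed
  qed
qed

section \<open>Rearrangements of the multiset as tail words, and equality of polynomials\<close>

text \<open>The tail already fixes the set of letters, so belonging to the multiset only prescribes
  the multiplicities of \<open>1..m\<close>.\<close>

lemma words_with_tail_eq_tail_words:
  assumes "\<tau> \<in> permutations_of_set {1..m}"
  shows "words_with_tail (multiset_of_mults m k) \<tau> = tail_words (rev \<tau>) k"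
proof -
  have \<tau>: "set \<tau> = {1..m}" using assms by (simp add: permutations_of_set_def)
  have c: "count (multiset_of_mults m k) a = (if a \<in> {1..m} then k a else 0)" for a
    by (simp add: multiset_of_mults_def count_sum)
  have "mset w = multiset_of_mults m k \<longleftrightarrow> (\<forall>a\<in>{1..m}. count_list w a = k a)" if "set w = {1..m}" for w
  proof -
    have "count_list w a = 0" if "a \<notin> {1..m}" for a
      using that \<open>set w = {1..m}\<close> by (simp add: count_list_0_iff)
    then show ?thesis unfolding multiset_eq_iff count_mset c by auto
  qed
  moreover have "set w = {1..m}" if "remdups w = \<tau>" for w
    using that \<tau> set_remdups[of w] by simp
  ultimately show ?thesis
    by (auto simp: words_with_tail_def tail_words_def tail_permutation_eq_remdups \<tau>
        permutations_of_multiset_def)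
qed

text \<open>Integer polynomials agreeing at the infinitely many integers above 1 are equal. Real
  \<open>q > 1\<close> keeps the denominators of the q-binomials nonzero.\<close>

lemma gen_poly_eqI:
  assumes "\<And>q::real. q > 1 \<Longrightarrow> (\<Sum>w\<in>W. q ^ f w) = (\<Sum>w\<in>W. q ^ g w)"
  shows "gen_poly f W = gen_poly g W"
proof (rule ccontr)
  assume "gen_poly f W \<noteq> gen_poly g W"
  then have fin: "finite {t. poly (gen_poly f W - gen_poly g W) t = 0}"
    by (intro poly_roots_finite) simp
  have "poly (gen_poly f W) t = poly (gen_poly g W) t" if "t > 1" for t
  proof -
    have "of_int (poly (gen_poly h W) t) = (\<Sum>w\<in>W. of_int t ^ h w :: real)" for h
      by (simp add: gen_poly_def poly_sum poly_monom)
    then have "real_of_int (poly (gen_poly f W) t) = of_int (poly (gen_poly g W) t)"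
      using assms[of "of_int t"] that by simp
    then show ?thesis by simp
  qed
  then have "{1<..} \<subseteq> {t. poly (gen_poly f W - gen_poly g W) t = 0}" by auto
  then show False using fin infinite_Ioi finite_subset by blast
qed

theorem theorem2p3:
  fixes m d :: nat and k :: "nat \<Rightarrow> nat" and \<tau> :: "nat list" and M :: "nat multiset"
  assumes "\<And>i. i \<in> {1..m} \<Longrightarrow> k i \<ge> 1"
    and "M = multiset_of_mults m k"
    and "\<tau> \<in> permutations_of_set {1..m}"
    and "consecutive \<tau>"
    and "d \<ge> 1"
  shows "gen_poly INV (words_with_tail M \<tau>) = gen_poly MAJ (words_with_tail M \<tau>)
       \<and> gen_poly MAJ (words_with_tail M \<tau>) = gen_poly (MAJ_d d) (words_with_tail M \<tau>)
       \<and> gen_poly (MAJ_d d) (words_with_tail M \<tau>) = gen_poly (Z m) (words_with_tail M \<tau>)"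
proof -
  have \<tau>: "distinct (rev \<tau>)" "set (rev \<tau>) = {1..m}"
    using assms(3) by (auto simp: permutations_of_set_def)
  \<comment> \<open>Both sums equal \<open>tail_gf\<close> at every real \<open>q > 1\<close>;
    consecutiveness enters only on the side of \<open>INV\<close>.\<close>
  have "gen_poly INV (words_with_tail M \<tau>) = gen_poly (Z m) (words_with_tail M \<tau>)"
    unfolding assms(2) words_with_tail_eq_tail_words[OF assms(3)]
    by (rule gen_poly_eqI) (use assms \<tau> in \<open>simp add: sum_INV_tail_words sum_Z_tail_words\<close>)
  then show ?thesis
    using gen_poly_INV_MAJ_d[OF assms(5,4), of M] gen_poly_INV_MAJ_d[OF order_refl assms(4), of M]
    unfolding MAJ_eq_MAJ_d by simp
qed

end
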